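(* Let $n\ge 1$, let $X=H_{\mathbb R}^n$ be real hyperbolic space with geodesic distance $d$, let $\mathfrak S$ be the space of hyperplanes of $X$, and let $\mu_{\mathfrak S}$ be a nonzero positive $G$-invariant measure on $\mathfrak S$, where $G=O(1,n)$. Then there is a constant $k>0$ such that for all $x,y\in X$, $$\mu_{\mathfrak S}\{S\in\mathfrak S : S\cap[xy]\neq\emptyset\}=k\,d(x,y).$$
   Context: On $\mathbb R^{n+1}$ consider the form $\langle z,w\rangle=-z^0w^0+z^1w^1+\cdots+z^nw^n$. Real hyperbolic space $X=H_{\mathbb R}^n$ is the image in projective space $P_{\mathbb R}^n$ of the set of negative vectors $\{x\in\mathbb R^{n+1}:\langle x,x\rangle<0\}$; the same notation is used for a negative vector and its class. The geodesic distance is given by $\cosh d(x,y)=\frac{|\langle x,y\rangle|}{(\langle x,x\rangle\langle y,y\rangle)^{1/2}}$. The group $G=O(1,n)$ is the subgroup of $GL(n+1,\mathbb R)$ preserving $\langle\cdot,\cdot\rangle$; it acts isometrically and transitively on $X$. Let $S_0\subset X$ be the subspace of points whose last coordinate is zero (a copy of $H_{\mathbb R}^{n-1}$). A hyperplane of $X$ is a $G$-translate $gS_0$; these are exactly the totally geodesic submanifolds of codimension one. The space $\mathfrak S$ of all hyperplanes is identified with the topological homogeneous space $G/G(S_0)$, where $G(S_0)=\{g\in G: gS_0=S_0\}$. There is a nonzero positive $G$-invariant (Radon) measure on $\mathfrak S$, unique up to a positive multiple. For $x,y\in X$, $[xy]$ denotes the unique geodesic segment from $x$ to $y$. *)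

theory Defs
  imports "HOL-Analysis.Analysis"
begin

text \<open>
  The space \<open>\<real>\<^sup>n\<^sup>+\<^sup>1\<close> is \<open>real ^ 'm\<close> for a finite linearly ordered index type \<open>'m\<close> with
  \<open>n + 1\<close> elements: the coordinate called \<open>0\<close> is \<open>Min UNIV\<close>, the last one is \<open>Max UNIV\<close>.
\<close>

definition lform :: "(real, 'm::{finite,linorder}) vec \<Rightarrow> (real, 'm) vec \<Rightarrow> real" where
  "lform z w = - (z $ Min UNIV) * (w $ Min UNIV) + (\<Sum>i\<in>UNIV - {Min UNIV}. z $ i * w $ i)"

text \<open>
  A point of projective space is a line through the origin, regarded as a subset of
  \<open>\<real>\<^sup>n\<^sup>+\<^sup>1\<close>; the class of a nonzero vector is the line it spans.
\<close>

type_synonym 'm point = "(real, 'm) vec set"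

definition proj_class :: "(real, 'm::finite) vec \<Rightarrow> 'm point" where
  "proj_class x = span {x}"

definition hyp_space :: "('m::{finite,linorder}) point set" where
  "hyp_space = proj_class ` {x. lform x x < 0}"

text \<open>
  The description does not depend on the representatives \<open>x\<close>, \<open>y\<close>, and it determines a
  distance on \<open>hyp_space\<close>; see \<open>hyp_dist_proj_class\<close> below.
\<close>

definition hyp_dist :: "('m::{finite,linorder}) point \<Rightarrow> 'm point \<Rightarrow> real" where
  "hyp_dist P Q = (THE d. 0 \<le> d \<and>
     (\<forall>x\<in>P - {0}. \<forall>y\<in>Q - {0}. cosh d = \<bar>lform x y\<bar> / sqrt (lform x x * lform y y)))"

definition is_geodesic_segment ::
    "('m::{finite,linorder}) point \<Rightarrow> 'm point \<Rightarrow> 'm point set \<Rightarrow> bool" where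
  "is_geodesic_segment P Q s \<longleftrightarrow>
     (\<exists>\<gamma> :: real \<Rightarrow> 'm point. \<gamma> 0 = P \<and> \<gamma> (hyp_dist P Q) = Q \<and>
        \<gamma> ` {0..hyp_dist P Q} = s \<and> s \<subseteq> hyp_space \<and>
        (\<forall>a\<in>{0..hyp_dist P Q}. \<forall>b\<in>{0..hyp_dist P Q}. hyp_dist (\<gamma> a) (\<gamma> b) = \<bar>a - b\<bar>))"

definition geodesic_segment ::
    "('m::{finite,linorder}) point \<Rightarrow> 'm point \<Rightarrow> 'm point set" where
  "geodesic_segment P Q = (THE s. is_geodesic_segment P Q s)"

definition O1n :: "((real, 'm) vec, 'm::{finite,linorder}) vec set" where
  "O1n = {g. invertible g \<and> (\<forall>z w. lform (g *v z) (g *v w) = lform z w)}"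

definition act_point :: "((real, 'm) vec, 'm::finite) vec \<Rightarrow> 'm point \<Rightarrow> 'm point" where
  "act_point g P = (*v) g ` P"

definition act_set :: "((real, 'm) vec, 'm::finite) vec \<Rightarrow> 'm point set \<Rightarrow> 'm point set" where
  "act_set g S = act_point g ` S"

definition hyp_S0 :: "('m::{finite,linorder}) point set" where
  "hyp_S0 = {P \<in> hyp_space. \<forall>x\<in>P. x $ Max UNIV = 0}"

definition hyperplanes :: "('m::{finite,linorder}) point set set" where
  "hyperplanes = (\<lambda>g. act_set g hyp_S0) ` O1n"

text \<open>
  The topology carried over from \<open>G / G(S\<^sub>0)\<close> by the bijection \<open>g G(S\<^sub>0) \<mapsto> g S\<^sub>0\<close> is the
  quotient topology for the orbit map \<open>g \<mapsto> g S\<^sub>0\<close>, where \<open>G = O(1,n)\<close> has the subspace topology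
  of the space of matrices.
\<close>

definition hyperplane_topology :: "('m::{finite,linorder}) point set topology" where
  "hyperplane_topology = topology (\<lambda>U. U \<subseteq> hyperplanes \<and>
     openin (top_of_set O1n) {g \<in> O1n. act_set g hyp_S0 \<in> U})"

definition radon_measure :: "'a topology \<Rightarrow> 'a measure \<Rightarrow> bool" where
  "radon_measure T M \<longleftrightarrow>
     space M = topspace T \<and>
     sets M = sigma_sets (topspace T) {U. openin T U} \<and>
     (\<forall>K. compactin T K \<longrightarrow> emeasure M K < \<infinity>) \<and>
     (\<forall>A\<in>sets M. emeasure M A = (INF U\<in>{U. openin T U \<and> A \<subseteq> U}. emeasure M U)) \<and>
     (\<forall>U. openin T U \<longrightarrow> emeasure M U = (SUP K\<in>{K. compactin T K \<and> K \<subseteq> U}. emeasure M K))"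

definition O1n_invariant :: "('m::{finite,linorder}) point set measure \<Rightarrow> bool" where
  "O1n_invariant M \<longleftrightarrow>
     (\<forall>g\<in>O1n. \<forall>A\<in>sets M. act_set g ` A \<in> sets M \<and> emeasure M (act_set g ` A) = emeasure M A)"

lemma openin_hyperplane_topology:
  fixes U :: "('m::{finite,linorder}) point set set"
  shows "openin hyperplane_topology U \<longleftrightarrow>
     U \<subseteq> hyperplanes \<and> openin (top_of_set O1n) {g \<in> O1n. act_set g hyp_S0 \<in> U}"
proof -
  have "istopology (\<lambda>U. U \<subseteq> hyperplanes \<and>
     openin (top_of_set (O1n::((real,'m) vec, 'm) vec set)) {g \<in> O1n. act_set g hyp_S0 \<in> U})"
    unfolding istopology_def
  proof (intro conjI allI impI)
    fix S T :: "'m point set set"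
    assume S: "S \<subseteq> hyperplanes \<and> openin (top_of_set O1n) {g \<in> O1n. act_set g hyp_S0 \<in> S}"
      and T: "T \<subseteq> hyperplanes \<and> openin (top_of_set O1n) {g \<in> O1n. act_set g hyp_S0 \<in> T}"
    show "S \<inter> T \<subseteq> hyperplanes" using S by blast
    have "{g \<in> O1n. act_set g hyp_S0 \<in> S \<inter> T} =
        {g \<in> O1n. act_set g hyp_S0 \<in> S} \<inter> {g \<in> O1n. act_set g hyp_S0 \<in> T}" by blast
    then show "openin (top_of_set O1n) {g \<in> O1n. act_set g hyp_S0 \<in> S \<inter> T}"
      using S T by (simp add: openin_Int)
  next
    fix K :: "'m point set set set"
    assume K: "\<forall>S\<in>K. S \<subseteq> hyperplanes \<and>
      openin (top_of_set O1n) {g \<in> O1n. act_set g hyp_S0 \<in> S}"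
    show "\<Union>K \<subseteq> hyperplanes" using K by blast
    have "{g \<in> O1n. act_set g hyp_S0 \<in> \<Union>K} =
        \<Union>((\<lambda>S. {g \<in> O1n. act_set g hyp_S0 \<in> S}) ` K)" by blast
    then show "openin (top_of_set O1n) {g \<in> O1n. act_set g hyp_S0 \<in> \<Union>K}"
      using K by auto
  qed
  then show ?thesis
    unfolding hyperplane_topology_def by (simp add: topology_inverse')
qed

lemma topspace_hyperplane_topology:
  "topspace hyperplane_topology = (hyperplanes :: ('m::{finite,linorder}) point set set)"
proof -
  have "{g \<in> O1n. act_set g hyp_S0 \<in> hyperplanes} = (O1n :: ((real, 'm) vec, 'm) vec set)"
    by (auto simp: hyperplanes_def)
  then have "openin hyperplane_topology (hyperplanes :: 'm point set set)"
    by (simp add: openin_hyperplane_topology)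
  then show ?thesis
    by (meson openin_hyperplane_topology openin_subset openin_topspace subset_antisym)
qed

lemma quotient_map_hyperplane_topology:
  "quotient_map (top_of_set O1n) hyperplane_topology (\<lambda>g. act_set g hyp_S0)"
  unfolding quotient_map_def
  by (simp add: topspace_hyperplane_topology openin_hyperplane_topology hyperplanes_def)

lemma lform_scaleR: "lform (a *\<^sub>R x) (b *\<^sub>R y) = a * b * lform x y"
  by (simp add: lform_def algebra_simps sum_distrib_left)

lemma lform_reverse_Cauchy_Schwarz:
  assumes x: "lform x x < 0" and y: "lform y y < 0"
  shows "sqrt (lform x x * lform y y) \<le> \<bar>lform x y\<bar>"
proof -
  let ?I = "UNIV - {Min UNIV}"
  define a b where "a = \<bar>x $ Min UNIV\<bar>" and "b = \<bar>y $ Min UNIV\<bar>"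
  define p q where "p = L2_set (($) x) ?I" and "q = L2_set (($) y) ?I"
  have pq: "0 \<le> p" "0 \<le> q" "0 \<le> a" "0 \<le> b"
    by (auto simp: p_def q_def a_def b_def)
  have fx: "lform x x = p\<^sup>2 - a\<^sup>2" and fy: "lform y y = q\<^sup>2 - b\<^sup>2"
    by (auto simp: lform_def p_def q_def a_def b_def L2_set_def sum_nonneg power2_eq_square)
  have "p < a" "q < b"
    using x y pq by (auto simp: fx fy intro: power2_less_imp_less)
  have "\<bar>\<Sum>i\<in>?I. x $ i * y $ i\<bar> \<le> (\<Sum>i\<in>?I. \<bar>x $ i\<bar> * \<bar>y $ i\<bar>)"
    by (metis (no_types, lifting) abs_mult sum_abs sum.cong)
  also have "\<dots> \<le> p * q"
    unfolding p_def q_def by (rule L2_set_mult_ineq)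
  finally have "a * b - p * q \<le> \<bar>lform x y\<bar>"
    by (simp add: lform_def a_def b_def flip: abs_mult)
  moreover have "0 \<le> a * b - p * q"
    using \<open>p < a\<close> \<open>q < b\<close> pq by (simp add: mult_mono)
  moreover have "lform x x * lform y y \<le> (a * b - p * q)\<^sup>2"
  proof -
    have "(a * b - p * q)\<^sup>2 - lform x x * lform y y = (a * q - b * p)\<^sup>2"
      unfolding fx fy by (simp add: power2_eq_square algebra_simps)
    then show ?thesis by (metis zero_le_power2 diff_ge_0_iff_ge)
  qed
  ultimately show ?thesis
    by (meson order_trans real_le_lsqrt)
qed

lemma hyp_dist_proj_class:
  assumes x: "lform x x < 0" and y: "lform y y < 0"
  shows "0 \<le> hyp_dist (proj_class x) (proj_class y)"
    and "cosh (hyp_dist (proj_class x) (proj_class y)) =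
           \<bar>lform x y\<bar> / sqrt (lform x x * lform y y)"
proof -
  define c where "c = \<bar>lform x y\<bar> / sqrt (lform x x * lform y y)"
  have pos: "0 < lform x x * lform y y" using x y by (rule mult_neg_neg)
  have c: "1 \<le> c"
    using lform_reverse_Cauchy_Schwarz[OF x y] pos by (simp add: c_def)
  have rep: "\<bar>lform u v\<bar> / sqrt (lform u u * lform v v) = c"
    if uv: "u \<in> proj_class x - {0}" "v \<in> proj_class y - {0}" for u v
  proof -
    obtain s t where st: "u = s *\<^sub>R x" "v = t *\<^sub>R y"
      using uv unfolding proj_class_def span_singleton by blast
    with uv have "s \<noteq> 0" "t \<noteq> 0" by auto
    have "sqrt (lform u u * lform v v) = sqrt ((s * t)\<^sup>2 * (lform x x * lform y y))"
      by (simp add: st lform_scaleR power2_eq_square algebra_simps)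
    also have "\<dots> = \<bar>s * t\<bar> * sqrt (lform x x * lform y y)"
      by (simp only: real_sqrt_mult real_sqrt_abs)
    finally show ?thesis
      using \<open>s \<noteq> 0\<close> \<open>t \<noteq> 0\<close> by (simp add: st lform_scaleR c_def abs_mult)
  qed
  have "x \<noteq> 0" "y \<noteq> 0" using x y by (auto simp: lform_def)
  then have mem: "x \<in> proj_class x - {0}" "y \<in> proj_class y - {0}"
    by (auto simp: proj_class_def span_base)
  let ?P = "\<lambda>d. 0 \<le> d \<and> (\<forall>u\<in>proj_class x - {0}. \<forall>v\<in>proj_class y - {0}.
    cosh d = \<bar>lform u v\<bar> / sqrt (lform u u * lform v v))"
  have "?P (hyp_dist (proj_class x) (proj_class y))"
    unfolding hyp_dist_def
  proof (rule theI)
    show "?P (arcosh c)"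
      using c rep by simp
  next
    fix d assume d: "?P d"
    then have "cosh d = c" using mem unfolding c_def by blast
    then show "d = arcosh c" using d by (auto simp: arcosh_cosh_real)
  qed
  then show "0 \<le> hyp_dist (proj_class x) (proj_class y)"
    "cosh (hyp_dist (proj_class x) (proj_class y)) = \<bar>lform x y\<bar> / sqrt (lform x x * lform y y)"
    using mem by auto
qed

end

theory Submission
  imports Defs
begin

text \<open>
  A hyperplane \<open>g S\<^sub>0\<close> is the set of negative lines orthogonal to the spacelike unit vector
  \<open>v = g e\<close>, where \<open>e\<close> is the last basis vector. If \<open>x\<close> and \<open>y\<close> are negative vectors with
  \<open>\<langle>x, y\<rangle> < 0\<close>, the geodesic segment between their classes is the projection of the linear
  segment from \<open>x\<close> to \<open>y\<close>, and the hyperplane orthogonal to \<open>v\<close> meets it iff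
  \<open>\<langle>x, v\<rangle> \<langle>y, v\<rangle> \<le> 0\<close> (lemmas \<open>crossing_iff\<close> and \<open>crossing_geodesic_segment\<close>).
  Everything about the incidence of hyperplanes and segments is read off from the signs of
  these two numbers.

  Let \<open>\<mu>\<close> be the invariant measure. As \<open>O(1,n)\<close> acts transitively on pairs of points at a given
  distance, the mass of the hyperplanes crossing a segment is a function \<open>f\<close> of its length
  (\<open>emeasure_crossing\<close>). This function is finite because those hyperplanes form a compact
  set (\<open>compactin_meeting\<close>). If a segment is cut at an interior point \<open>p\<close>, a hyperplane crosses
  the whole iff it crosses one of the parts, and it crosses both only if it contains \<open>p\<close>.
  Hence \<open>f\<close> is additive once the hyperplanes through a point are known to form a null set, and
  a nonnegative additive function on the half-line is \<open>t \<mapsto> f(1) t\<close>. The constant \<open>f(1)\<close> is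
  positive: countably many segments suffice to be crossed by every hyperplane, so \<open>f = 0\<close> would
  make \<open>\<mu>\<close> vanish.

  That a pencil of hyperplanes through a point is null (\<open>emeasure_pencil\<close>) is seen as follows. By
  invariance all pencils have the same mass. Take the pencils at infinitely many points of a
  bounded piece of the moment curve. They lie in one compact set, hence in a set of finite mass,
  while each hyperplane belongs to only finitely many of them, since a nonzero polynomial has
  finitely many roots. Their common mass is therefore zero.

  Both transitivity and compactness come from explicit reflections: the reflection in \<open>u - v\<close>
  exchanges two vectors \<open>u\<close> and \<open>v\<close> of equal norm, and it depends continuously on them as long as
  \<open>u - v\<close> is not isotropic. The hypothesis that the least and the greatest index differ says that
  the dimension \<open>n\<close> is at least \<open>1\<close>.
\<close>

section \<open>The Lorentz form\<close>

type_synonym 'm rvec = "(real, 'm) vec"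

lemma lform_eq_inner: "lform z w = z \<bullet> w - 2 * (z $ Min UNIV * w $ Min UNIV)"
proof -
  have "z \<bullet> w = z $ Min UNIV * w $ Min UNIV + (\<Sum>i\<in>UNIV - {Min UNIV}. z $ i * w $ i)"
    by (simp add: inner_vec_def sum.remove[of UNIV "Min UNIV"])
  then show ?thesis by (simp add: lform_def)
qed

lemma lform_self: "lform z z = (norm z)\<^sup>2 - 2 * (z $ Min UNIV)\<^sup>2"
  unfolding power2_norm_eq_inner by (simp add: lform_eq_inner power2_eq_square)

interpretation lform: bounded_bilinear "lform :: 'm::{finite,linorder} rvec \<Rightarrow> 'm rvec \<Rightarrow> real"
  unfolding bilinear_conv_bounded_bilinear[symmetric] bilinear_def
  by (auto intro!: linearI simp: lform_eq_inner inner_simps algebra_simps)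

lemma lform_commute: "lform z w = lform w z"
  by (simp add: lform_eq_inner inner_commute)

lemmas lform_simps = lform.add_left lform.add_right lform.diff_left lform.diff_right
  lform.minus_left lform.minus_right lform.scaleR_left lform.scaleR_right

text \<open>
  By Cauchy--Schwarz for the Euclidean inner product: orthogonality reads \<open>x \<bullet> z = 2
  x\<^sub>0 z\<^sub>0\<close>, and \<open>x\<close> being negative reads
  \<open>\<parallel>x\<parallel>\<^sup>2 < 2 x\<^sub>0\<^sup>2\<close>.
\<close>

lemma spacelike_if_orthogonal_timelike:
  assumes x: "lform x x < 0" and z: "lform x z = 0" "z \<noteq> 0"
  shows "0 < lform z z"
proof -
  define a b where "a = x $ Min UNIV" and "b = z $ Min UNIV"
  have na: "(norm x)\<^sup>2 < 2 * a\<^sup>2"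
    using x by (simp add: lform_self a_def)
  then have a: "0 < a\<^sup>2" by (smt (verit) zero_le_power2)
  have "4 * (a\<^sup>2 * b\<^sup>2) = (x \<bullet> z)\<^sup>2"
    using z by (simp add: lform_eq_inner a_def b_def power2_eq_square)
  also have "\<dots> \<le> (norm x)\<^sup>2 * (norm z)\<^sup>2"
    using Cauchy_Schwarz_ineq[of x z] by (simp add: power2_norm_eq_inner)
  also have "\<dots> < (2 * a\<^sup>2) * (norm z)\<^sup>2"
    using na z(2) by (intro mult_strict_right_mono) auto
  finally have "a\<^sup>2 * (2 * b\<^sup>2) < a\<^sup>2 * (norm z)\<^sup>2" by simp
  then have "2 * b\<^sup>2 < (norm z)\<^sup>2" using a by simp
  then show ?thesis
    by (simp add: lform_self b_def)
qed

text \<open>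
  The equality case of the reversed Cauchy--Schwarz inequality: the difference \<open>x - y\<close>
  is isotropic and orthogonal to \<open>x\<close>, hence zero.
\<close>

lemma unit_timelike_eqI:
  assumes "lform x x = -1" "lform y y = -1" "lform x y = -1"
  shows "x = y"
proof (rule ccontr)
  assume "x \<noteq> y"
  then have "0 < lform (x - y) (x - y)"
    using assms by (intro spacelike_if_orthogonal_timelike[of x]) (auto simp: lform_simps)
  then show False using assms by (simp add: lform_simps lform_commute[of y x])
qed

section \<open>Reflections and transitivity of the Lorentz group\<close>

definition lform_reflection :: "'m rvec \<Rightarrow> ('m rvec, 'm::{finite,linorder}) vec" where
  "lform_reflection w = matrix (\<lambda>z. z - (2 * lform z w / lform w w) *\<^sub>R w)"

lemma lform_reflection_apply: "lform_reflection w *v z = z - (2 * lform z w / lform w w) *\<^sub>R w"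
  unfolding lform_reflection_def
  by (rule matrix_works)
    (auto intro!: linearI simp: linear_matrix_vector_mul_eq lform_simps algebra_simps add_divide_distrib)

lemma O1n_lform: "g \<in> O1n \<Longrightarrow> lform (g *v z) (g *v w) = lform z w"
  by (simp add: O1n_def)

lemma mat_1_in_O1n: "mat 1 \<in> O1n"
  by (auto simp: O1n_def invertible_def intro!: exI[of _ "mat 1"])

lemma mult_in_O1n: "g \<in> O1n \<Longrightarrow> h \<in> O1n \<Longrightarrow> g ** h \<in> O1n"
  by (auto simp: O1n_def invertible_mult simp flip: matrix_vector_mul_assoc)

lemma O1n_inverse:
  assumes "g \<in> O1n"
  obtains h where "h \<in> O1n" "\<And>z. g *v (h *v z) = z" "\<And>z. h *v (g *v z) = z"
proof -
  obtain h where h: "g ** h = mat 1" "h ** g = mat 1"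
    using assms by (auto simp: O1n_def invertible_def)
  then have gh: "g *v (h *v z) = z" "h *v (g *v z) = z" for z
    by (simp_all add: matrix_vector_mul_assoc)
  have "lform (h *v z) (h *v w) = lform z w" for z w
    using O1n_lform[OF assms, of "h *v z" "h *v w"] by (simp add: gh)
  then have "h \<in> O1n" using h by (auto simp: O1n_def invertible_def)
  then show ?thesis using that gh by blast
qed

text \<open>
  The reflection is an involution that negates the component along \<open>w\<close>.
\<close>

lemma lform_reflection_in_O1n:
  assumes "lform w w \<noteq> 0"
  shows "lform_reflection w \<in> O1n"
proof -
  have flip: "lform (lform_reflection w *v z) w = - lform z w" for z
    using assms by (simp add: lform_reflection_apply lform_simps)
  have "lform_reflection w *v (lform_reflection w *v z) = z" for z
    by (subst lform_reflection_apply) (simp add: flip, simp add: lform_reflection_apply)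
  then have "lform_reflection w ** lform_reflection w = mat 1"
    by (simp add: matrix_eq flip: matrix_vector_mul_assoc)
  moreover have "lform (lform_reflection w *v z) (lform_reflection w *v u) = lform z u" for z u
  proof -
    have "lform (lform_reflection w *v z) (lform_reflection w *v u) =
        lform (lform_reflection w *v z) u + 2 * lform u w / lform w w * lform z w"
      by (subst (2) lform_reflection_apply) (simp add: lform_simps flip)
    also have "lform (lform_reflection w *v z) u = lform z u - 2 * lform z w / lform w w * lform u w"
      by (simp add: lform_reflection_apply lform_simps lform_commute[of w u])
    finally show ?thesis by simp
  qed
  ultimately show ?thesis by (auto simp: O1n_def invertible_def)
qed

lemma lform_reflection_swaps:
  assumes "lform x x = lform y y" "lform (x - y) (x - y) \<noteq> 0"
  shows "lform_reflection (x - y) *v x = y"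
proof -
  have "2 * lform x (x - y) = lform (x - y) (x - y)"
    using assms(1) by (simp add: lform_simps lform_commute[of y x])
  then show ?thesis using assms(2) by (simp add: lform_reflection_apply)
qed

lemma lform_reflection_fixes: "lform z w = 0 \<Longrightarrow> lform_reflection w *v z = z"
  by (simp add: lform_reflection_apply)

lemma continuous_on_lform_reflection:
  "continuous_on {w. lform w w \<noteq> 0} (lform_reflection :: 'm rvec \<Rightarrow> ('m rvec, 'm::{finite,linorder}) vec)"
  unfolding lform_reflection_def matrix_def
  by (intro continuous_on_vec_lambda) (auto intro!: continuous_intros lform.continuous_on)

text \<open>
  Unless \<open>x = x'\<close>, the reflection in \<open>x - x'\<close> takes \<open>x\<close> to
  \<open>x'\<close>; it is defined because \<open>\<langle>x, x'\<rangle> \<noteq> -1\<close>. The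
  images of \<open>y\<close> and \<open>y'\<close> then differ by a vector orthogonal to the
  negative vector \<open>x'\<close>, which is spacelike unless it is zero, so the reflection in it
  is defined; it fixes \<open>x'\<close> and finishes the job.
\<close>

lemma O1n_transitive_on_pairs:
  assumes x: "lform x x = -1" "lform x' x' = -1" and y: "lform y y = lform y' y'"
    and xy: "lform x y = lform x' y'"
  obtains g where "g \<in> O1n" "g *v x = x'" "g *v y = y'"
proof -
  obtain g where g: "g \<in> O1n" "g *v x = x'"
  proof (cases "x = x'")
    case True
    then show ?thesis using that[OF mat_1_in_O1n] by simp
  next
    case False
    then have "lform x x' \<noteq> -1" using x unit_timelike_eqI by blast
    then have "lform (x - x') (x - x') \<noteq> 0"
      using x by (simp add: lform_simps lform_commute[of x' x])
    then show ?thesis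
      using x that[of "lform_reflection (x - x')"] by (simp add: lform_reflection_in_O1n lform_reflection_swaps)
  qed
  define z where "z = g *v y"
  have z: "lform z z = lform y' y'" "lform x' z = lform x' y'"
    using O1n_lform[OF g(1)] g(2) y xy by (auto simp: z_def)
  show ?thesis
  proof (cases "z = y'")
    case True
    with g show ?thesis using that by (simp add: z_def)
  next
    case False
    have orth: "lform x' (z - y') = 0" using z by (simp add: lform_simps)
    then have "0 < lform (z - y') (z - y')"
      using False x by (intro spacelike_if_orthogonal_timelike[of x']) auto
    then have nz: "lform (z - y') (z - y') \<noteq> 0" by simp
    have "lform_reflection (z - y') *v z = y'" "lform_reflection (z - y') *v x' = x'"
      using lform_reflection_swaps[OF z(1) nz] lform_reflection_fixes[OF orth] by auto
    then show ?thesis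
      using that[OF mult_in_O1n[OF lform_reflection_in_O1n[OF nz] g(1)]] g(2)
      by (simp add: z_def flip: matrix_vector_mul_assoc)
  qed
qed

section \<open>Hyperplanes as orthogonal complements of spacelike vectors\<close>

lemma act_set_mult: "act_set g (act_set h S) = act_set (g ** h) S"
  by (simp add: act_set_def act_point_def image_image matrix_vector_mul_assoc)

lemma act_set_hyperplane: "g \<in> O1n \<Longrightarrow> S \<in> hyperplanes \<Longrightarrow> act_set g S \<in> hyperplanes"
  by (auto simp: hyperplanes_def act_set_mult mult_in_O1n)

lemma act_point_proj_class: "act_point g (proj_class x) = proj_class (g *v x)"
  by (simp add: act_point_def proj_class_def span_singleton image_image matrix_vector_mult_scaleR)

lemma proj_class_scaleR: "a \<noteq> 0 \<Longrightarrow> proj_class (a *\<^sub>R x) = proj_class x"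
  unfolding proj_class_def using span_image_scale[of "{x}" "\<lambda>_. a"] by simp

abbreviation pole :: "'m::{finite,linorder} rvec" where
  "pole \<equiv> axis (Max UNIV) 1"

abbreviation origin :: "'m::{finite,linorder} rvec" where
  "origin \<equiv> axis (Min UNIV) 1"

lemma lform_origin: "lform origin (origin :: 'm::{finite,linorder} rvec) = -1"
  by (simp add: lform_eq_inner inner_axis)

lemma lform_pole:
  assumes "Min UNIV \<noteq> Max (UNIV :: 'm::{finite,linorder} set)"
  shows "lform z (pole :: 'm rvec) = z $ Max UNIV"
    "lform (pole :: 'm rvec) z = z $ Max UNIV"
  using assms by (simp_all add: lform_eq_inner inner_axis inner_axis') (simp_all add: axis_def)

text \<open>
  The base hyperplane \<open>S\<^sub>0\<close> is the orthogonal complement of the last basis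
  vector; translating by \<open>g\<close> gives the orthogonal complement of its image.
\<close>

lemma proj_class_mem_hyperplane:
  fixes p :: "'m::{finite,linorder} rvec"
  assumes dim: "Min UNIV \<noteq> Max (UNIV :: 'm set)"
    and g: "g \<in> O1n" and p: "lform p p < 0"
  shows "proj_class p \<in> act_set g hyp_S0 \<longleftrightarrow> lform p (g *v pole) = 0"
proof
  assume "proj_class p \<in> act_set g hyp_S0"
  then obtain P where P: "P \<in> hyp_S0" "proj_class p = (*v) g ` P"
    by (auto simp: act_set_def act_point_def)
  have "p \<in> proj_class p" by (simp add: proj_class_def span_base)
  then obtain q where "q \<in> P" "p = g *v q" using P by blast
  then show "lform p (g *v pole) = 0"
    using P by (simp add: O1n_lform[OF g] lform_pole[OF dim] hyp_S0_def)
next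
  assume 0: "lform p (g *v pole) = 0"
  obtain h where h: "h \<in> O1n" "\<And>z. g *v (h *v z) = z" "\<And>z. h *v (g *v z) = z"
    using O1n_inverse[OF g] by metis
  define q where "q = h *v p"
  have q: "p = g *v q" "lform q q < 0" using h p by (auto simp: q_def O1n_lform)
  have "q $ Max UNIV = 0" using 0 by (simp add: q O1n_lform[OF g] lform_pole[OF dim])
  then have "proj_class q \<in> hyp_S0"
    using q by (auto simp: hyp_S0_def hyp_space_def proj_class_def span_singleton)
  then show "proj_class p \<in> act_set g hyp_S0"
    by (simp add: act_set_def q flip: act_point_proj_class)
qed

lemma hyperplanesE:
  assumes "S \<in> hyperplanes"
  obtains g where "g \<in> O1n" "S = act_set g hyp_S0"
  using assms by (auto simp: hyperplanes_def)

text \<open>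
  Replacing \<open>v\<close> by \<open>-v\<close> does not change its orthogonal complement, so
  every hyperplane has a normal \<open>v\<close> with \<open>\<langle>e, v\<rangle> \<le> 0\<close>.
  For such normals \<open>\<langle>e - v, e - v\<rangle> \<ge> 2\<close>, and the reflection in
  \<open>e - v\<close> is a continuous choice of an isometry that takes \<open>S\<^sub>0\<close> to
  the hyperplane.
\<close>

lemma reflection_from_pole:
  fixes v :: "'m::{finite,linorder} rvec"
  assumes dim: "Min UNIV \<noteq> Max (UNIV :: 'm set)"
  assumes v: "lform v v = 1" "lform pole v \<le> 0"
  shows "lform (pole - v) (pole - v) \<noteq> 0" "lform_reflection (pole - v) *v pole = v"
proof -
  have 1: "lform pole (pole :: 'm rvec) = 1" by (simp add: lform_pole[OF dim])
  show "lform (pole - v) (pole - v) \<noteq> 0"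
    using v 1 by (simp add: lform_simps lform_commute[of v pole])
  then show "lform_reflection (pole - v) *v pole = v" using lform_reflection_swaps 1 v by metis
qed

lemma hyperplane_subset_hyp_space:
  assumes g: "g \<in> O1n" shows "act_set g hyp_S0 \<subseteq> hyp_space"
  using g by (auto simp: act_set_def hyp_S0_def hyp_space_def act_point_proj_class O1n_lform)

lemma hyperplane_eqI:
  fixes g h :: "('m rvec, 'm::{finite,linorder}) vec"
  assumes dim: "Min UNIV \<noteq> Max (UNIV :: 'm set)"
    and "g \<in> O1n" "h \<in> O1n" "g *v pole = h *v pole \<or> g *v pole = - (h *v pole)"
  shows "act_set g hyp_S0 = act_set h hyp_S0"
proof -
  have "P \<in> act_set g hyp_S0 \<longleftrightarrow> P \<in> act_set h hyp_S0" if "P \<in> hyp_space" for P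
    using that assms by (auto simp: hyp_space_def proj_class_mem_hyperplane[OF dim] lform_simps)
  then show ?thesis using hyperplane_subset_hyp_space assms(2,3) by blast
qed

section \<open>Hyperplanes meeting a compact set\<close>

text \<open>
  The set \<open>C\<close> consists of representatives in the vector space instead of points of
  hyperbolic space, so that its topology and linear structure are at hand.
\<close>

definition meeting :: "'m::{finite,linorder} rvec set \<Rightarrow> 'm point set set" where
  "meeting C = {S \<in> hyperplanes. \<exists>p\<in>C. proj_class p \<in> S}"

lemma meeting_subset: "meeting C \<subseteq> hyperplanes"
  by (auto simp: meeting_def)

lemma mem_meeting_iff:
  fixes g :: "('m rvec, 'm::{finite,linorder}) vec"
  assumes dim: "Min UNIV \<noteq> Max (UNIV :: 'm set)"
    and "g \<in> O1n" "\<And>p. p \<in> C \<Longrightarrow> lform p p < 0"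
  shows "act_set g hyp_S0 \<in> meeting C \<longleftrightarrow> (\<exists>p\<in>C. lform p (g *v pole) = 0)"
  using assms by (auto simp: meeting_def hyperplanes_def proj_class_mem_hyperplane)

text \<open>
  The preimage in \<open>O(1,n)\<close> is \<open>{g. \<exists>p\<in>C. \<langle>p, g e\<rangle> =
  0}\<close>, the projection of a closed set along the compact set \<open>C\<close>.
\<close>

lemma closedin_meeting:
  fixes C :: "'m::{finite,linorder} rvec set"
  assumes dim: "Min UNIV \<noteq> Max (UNIV :: 'm set)"
    and C: "compact C" "\<And>p. p \<in> C \<Longrightarrow> lform p p < 0"
  shows "closedin hyperplane_topology (meeting C)"
proof -
  let ?T = "{z :: 'm rvec \<times> ('m rvec, 'm) vec. lform (fst z) (snd z *v pole) = 0}"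
  have "{g \<in> O1n. act_set g hyp_S0 \<in> meeting C} = O1n \<inter> {g. \<exists>p. p \<in> C \<and> (p, g) \<in> ?T}"
    using mem_meeting_iff[OF dim _ C(2)] by auto
  moreover have "continuous_on UNIV (\<lambda>g :: ('m rvec, 'm) vec. g *v pole)"
    by (intro linear_continuous_on linear_conv_bounded_linear[THEN iffD1] linearI)
      (simp_all add: matrix_vector_mult_add_rdistrib scaleR_matrix_vector_assoc)
  then have "continuous_on UNIV (\<lambda>z :: 'm rvec \<times> ('m rvec, 'm) vec. snd z *v pole)"
    by (rule continuous_on_compose2) (auto intro: continuous_intros)
  then have "closed ?T"
    by (intro closed_Collect_eq lform.continuous_on continuous_intros)
  then have "closed {g. \<exists>p. p \<in> C \<and> (p, g) \<in> ?T}"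
    by (rule closed_compact_projection[OF C(1)])
  ultimately have "closedin (top_of_set O1n) {g \<in> O1n. act_set g hyp_S0 \<in> meeting C}"
    by (simp only: closedin_closed_Int)
  then show ?thesis
    using quotient_map_hyperplane_topology meeting_subset[of C]
    unfolding quotient_map_closedin topspace_hyperplane_topology topspace_euclidean_subtopology
    by blast
qed

text \<open>
  A unit normal \<open>v\<close> of a hyperplane that meets \<open>C\<close> is bounded: the ratio
  \<open>\<parallel>p\<parallel>\<^sup>2 / 2 p\<^sub>0\<^sup>2\<close> is at most some \<open>r <
  1\<close> on \<open>C\<close> by compactness, and Cauchy--Schwarz applied to \<open>p \<bullet> v
  = 2 p\<^sub>0 v\<^sub>0\<close> then gives \<open>\<parallel>v\<parallel>\<^sup>2 \<le> 1 / (1 -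
  r)\<close>. The hyperplanes in question thus lie in the image of a compact set of reflections.
\<close>

lemma compactin_meeting:
  fixes C :: "('m::{finite,linorder} rvec) set"
  assumes dim: "Min UNIV \<noteq> Max (UNIV :: 'm set)"
    and C: "compact C" "\<And>p. p \<in> C \<Longrightarrow> lform p p < 0"
  shows "compactin hyperplane_topology (meeting C)"
proof (cases "C = {}")
  case True
  then show ?thesis by (simp add: meeting_def)
next
  case False
  define \<rho> where "\<rho> p = (norm p)\<^sup>2 / (2 * (p $ Min UNIV)\<^sup>2)" for p :: "'m rvec"
  have time: "(norm p)\<^sup>2 < 2 * (p $ Min UNIV)\<^sup>2" "0 < (p $ Min UNIV)\<^sup>2" if "p \<in> C" for p
  proof -
    show "(norm p)\<^sup>2 < 2 * (p $ Min UNIV)\<^sup>2"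
      using C(2)[OF that] by (simp add: lform_self)
    then show "0 < (p $ Min UNIV)\<^sup>2" by (smt (verit) zero_le_power2)
  qed
  have "continuous_on C \<rho>"
    unfolding \<rho>_def using time(2) by (intro continuous_intros) fastforce
  then obtain p0 where p0: "p0 \<in> C" "\<And>p. p \<in> C \<Longrightarrow> \<rho> p \<le> \<rho> p0"
    using continuous_attains_sup[OF C(1) False] by metis
  define r where "r = \<rho> p0"
  have r: "r < 1" using time[OF p0(1)] by (simp add: r_def \<rho>_def)
  have bound: "(norm v)\<^sup>2 \<le> 1 / (1 - r)"
    if p: "p \<in> C" "lform p v = 0" and v: "lform v v = 1" for p v
  proof -
    define a b where "a = p $ Min UNIV" and "b = v $ Min UNIV"
    have nv: "(norm v)\<^sup>2 = 1 + 2 * b\<^sup>2"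
      using v by (simp add: lform_self b_def)
    have a: "0 < a\<^sup>2" using time p by (simp add: a_def)
    have "(norm p)\<^sup>2 \<le> 2 * a\<^sup>2 * r"
      using p0(2)[OF p(1)] a by (simp add: \<rho>_def r_def a_def field_simps)
    have "4 * (a\<^sup>2 * b\<^sup>2) = (p \<bullet> v)\<^sup>2"
      using p by (simp add: lform_eq_inner a_def b_def power2_eq_square)
    also have "\<dots> \<le> (norm p)\<^sup>2 * (norm v)\<^sup>2"
      using Cauchy_Schwarz_ineq[of p v] by (simp add: power2_norm_eq_inner)
    also have "\<dots> \<le> (2 * a\<^sup>2 * r) * (norm v)\<^sup>2"
      using \<open>(norm p)\<^sup>2 \<le> _\<close> by (intro mult_right_mono) auto
    finally have "a\<^sup>2 * (2 * b\<^sup>2) \<le> a\<^sup>2 * (r * (norm v)\<^sup>2)" by (simp add: mult_ac)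
    then have "2 * b\<^sup>2 \<le> r * (norm v)\<^sup>2"
      using a by (rule mult_left_le_imp_le)
    then have "(norm v)\<^sup>2 * (1 - r) \<le> 1"
      unfolding nv by (simp add: algebra_simps)
    then show ?thesis using r by (simp add: pos_le_divide_eq)
  qed
  define V where "V = {v :: 'm rvec. lform v v = 1 \<and> lform pole v \<le> 0 \<and> (norm v)\<^sup>2 \<le> 1 / (1 - r)}"
  have "closed V"
    unfolding V_def
    by (intro closed_Collect_conj closed_Collect_eq closed_Collect_le continuous_intros lform.continuous_on)
  moreover have "bounded V"
    unfolding bounded_iff V_def
    by (intro exI[of _ "sqrt (1 / (1 - r))"]) (auto intro: real_le_rsqrt)
  ultimately have V: "compact V" by (simp add: compact_eq_bounded_closed)
  have nz: "lform (pole - v) (pole - v) \<noteq> 0" and im: "lform_reflection (pole - v) *v pole = v" if "v \<in> V" for v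
    using reflection_from_pole[OF dim, of v] that by (auto simp: V_def)
  have "continuous_on V (\<lambda>v. lform_reflection (pole - v))"
    by (rule continuous_on_compose2[OF continuous_on_lform_reflection])
      (auto intro!: continuous_intros simp: nz)
  then have "compact ((\<lambda>v. lform_reflection (pole - v)) ` V)" using V by (rule compact_continuous_image)
  moreover have sub: "(\<lambda>v. lform_reflection (pole - v)) ` V \<subseteq> O1n" using nz lform_reflection_in_O1n by blast
  ultimately have "compactin (top_of_set O1n) ((\<lambda>v. lform_reflection (pole - v)) ` V)"
    by (simp add: compactin_subtopology)
  then have "compactin hyperplane_topology ((\<lambda>g. act_set g hyp_S0) ` (\<lambda>v. lform_reflection (pole - v)) ` V)"
    using image_compactin quotient_imp_continuous_map[OF quotient_map_hyperplane_topology] by blast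
  moreover have "meeting C \<subseteq> (\<lambda>g. act_set g hyp_S0) ` (\<lambda>v. lform_reflection (pole - v)) ` V"
  proof safe
    fix S assume "S \<in> meeting C"
    then obtain p where S: "S \<in> hyperplanes" and p: "p \<in> C" "proj_class p \<in> S"
      by (auto simp: meeting_def)
    obtain g where g: "g \<in> O1n" "S = act_set g hyp_S0" using S by (rule hyperplanesE)
    \<comment> \<open>Of the two unit normals, choose the one for which the reflection from the pole is defined.\<close>
  define v where "v = (if lform pole (g *v pole) \<le> 0 then g *v pole else - (g *v pole))"
    have v: "v = g *v pole \<or> v = - (g *v pole)" "lform pole v \<le> 0"
      by (auto simp: v_def lform_simps)
    have "lform v v = 1"
      using v g(1) by (auto simp: lform_simps O1n_lform lform_pole[OF dim])
    moreover have "lform p v = 0"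
      using p proj_class_mem_hyperplane[OF dim g(1) C(2)] g v by (auto simp: lform_simps)
    ultimately have "v \<in> V" using bound p v by (simp add: V_def)
    then have "S = act_set (lform_reflection (pole - v)) hyp_S0"
      unfolding g(2) using g(1) sub v im[OF \<open>v \<in> V\<close>] by (intro hyperplane_eqI[OF dim]) auto
    then show "S \<in> (\<lambda>g. act_set g hyp_S0) ` (\<lambda>v. lform_reflection (pole - v)) ` V"
      using \<open>v \<in> V\<close> by blast
  qed
  ultimately show ?thesis by (rule closed_compactin[OF _ _ closedin_meeting[OF dim C]])
qed

section \<open>Hyperplanes crossing a segment\<close>

definition crossing :: "'m::{finite,linorder} rvec \<Rightarrow> 'm rvec \<Rightarrow> 'm point set set" where
  "crossing x y = meeting (closed_segment x y)"

lemma crossing_subset: "crossing x y \<subseteq> hyperplanes"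
  by (simp add: crossing_def meeting_subset)

lemma timelike_on_segment:
  assumes "lform x x < 0" "lform y y < 0" "lform x y < 0" "p \<in> closed_segment x y"
  shows "lform p p < 0"
proof -
  obtain u where u: "0 \<le> u" "u \<le> 1" and p: "p = (1 - u) *\<^sub>R x + u *\<^sub>R y"
    using assms(4) by (auto simp: in_segment)
  have "lform p p = (1 - u)\<^sup>2 * lform x x + 2 * ((1 - u) * u) * lform x y + u\<^sup>2 * lform y y"
    unfolding p by (simp add: lform_simps lform_commute[of y x] power2_eq_square algebra_simps)
  moreover have "(1 - u)\<^sup>2 * lform x x \<le> 0" "2 * ((1 - u) * u) * lform x y \<le> 0"
      "u\<^sup>2 * lform y y \<le> 0"
    using u assms(1-3) by (intro mult_nonneg_nonpos mult_nonneg_nonneg; simp)+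
  moreover have "u\<^sup>2 * lform y y < 0 \<or> (1 - u)\<^sup>2 * lform x x < 0"
    using assms(1,2) by (cases "u = 0") (auto simp: mult_less_0_iff)
  ultimately show ?thesis by linarith
qed

text \<open>
  The linear form \<open>\<langle>_, g e\<rangle>\<close> vanishes somewhere on a segment iff its
  values at the end points do not have the same strict sign.
\<close>

lemma crossing_iff:
  fixes g :: "('m rvec, 'm::{finite,linorder}) vec"
  assumes dim: "Min UNIV \<noteq> Max (UNIV :: 'm set)"
    and g: "g \<in> O1n" and xy: "lform x x < 0" "lform y y < 0" "lform x y < 0"
  shows "act_set g hyp_S0 \<in> crossing x y \<longleftrightarrow> lform x (g *v pole) * lform y (g *v pole) \<le> 0"
    (is "_ \<longleftrightarrow> ?a * ?b \<le> 0")
proof -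
  have "act_set g hyp_S0 \<in> crossing x y \<longleftrightarrow> (\<exists>p\<in>closed_segment x y. lform p (g *v pole) = 0)"
    unfolding crossing_def by (rule mem_meeting_iff[OF dim g timelike_on_segment[OF xy]])
  also have "\<dots> \<longleftrightarrow> 0 \<in> (\<lambda>p. lform p (g *v pole)) ` closed_segment x y"
    by (auto simp: image_iff)
  also have "\<dots> \<longleftrightarrow> 0 \<in> closed_segment ?a ?b"
    by (subst closed_segment_linear_image)
      (auto intro: bounded_linear.linear lform.bounded_linear_left)
  also have "\<dots> \<longleftrightarrow> ?a * ?b \<le> 0"
    by (auto simp: closed_segment_eq_real_ivl mult_le_0_iff)
  finally show ?thesis .
qed

lemma crossing_scaleR:
  fixes x y :: "'m::{finite,linorder} rvec"
  assumes dim: "Min UNIV \<noteq> Max (UNIV :: 'm set)"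
    and xy: "lform x x < 0" "lform y y < 0" "lform x y < 0" and ab: "0 < a" "0 < b"
  shows "crossing (a *\<^sub>R x) (b *\<^sub>R y) = crossing x y"
proof -
  have "S \<in> crossing (a *\<^sub>R x) (b *\<^sub>R y) \<longleftrightarrow> S \<in> crossing x y" if S: "S \<in> hyperplanes" for S
  proof -
    obtain g where g: "g \<in> O1n" "S = act_set g hyp_S0" using S by (rule hyperplanesE)
    have neg: "lform (a *\<^sub>R x) (a *\<^sub>R x) < 0" "lform (b *\<^sub>R y) (b *\<^sub>R y) < 0"
        "lform (a *\<^sub>R x) (b *\<^sub>R y) < 0"
      using xy ab by (auto simp: lform_simps mult_less_0_iff)
    show ?thesis
      unfolding g(2) crossing_iff[OF dim g(1) xy] crossing_iff[OF dim g(1) neg]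
      using ab by (auto simp: lform_simps mult_le_0_iff zero_le_mult_iff)
  qed
  then show ?thesis using crossing_subset by blast
qed

lemma act_set_crossing:
  assumes "g \<in> O1n"
  shows "act_set g ` crossing x y \<subseteq> crossing (g *v x) (g *v y)"
proof safe
  fix S assume "S \<in> crossing x y"
  then obtain p where p: "S \<in> hyperplanes" "p \<in> closed_segment x y" "proj_class p \<in> S"
    by (auto simp: crossing_def meeting_def)
  have "g *v p \<in> closed_segment (g *v x) (g *v y)"
    using p(2) by (auto simp: in_segment matrix_vector_right_distrib matrix_vector_mult_scaleR)
  moreover have "proj_class (g *v p) \<in> act_set g S"
    using p(3) by (simp add: act_set_def flip: act_point_proj_class)
  ultimately show "act_set g S \<in> crossing (g *v x) (g *v y)"
    using act_set_hyperplane[OF assms p(1)] by (auto simp: crossing_def meeting_def)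
qed

text \<open>
  The value of the linear form \<open>\<langle>_, v\<rangle>\<close> at \<open>y\<close> is a
  positive combination of its values at \<open>x\<close> and \<open>z\<close>; both claims only
  compare signs.
\<close>

lemma crossing_split:
  fixes x z :: "'m::{finite,linorder} rvec"
  assumes dim: "Min UNIV \<noteq> Max (UNIV :: 'm set)"
    and xz: "lform x x < 0" "lform z z < 0" "lform x z < 0"
    and y: "y = a *\<^sub>R x + b *\<^sub>R z" "0 < a" "0 < b"
  shows "crossing x y \<union> crossing y z = crossing x z" "crossing x y \<inter> crossing y z \<subseteq> crossing y y"
proof -
  have xy: "lform x y < 0" and yz: "lform y z < 0"
    using xz y(2,3) unfolding y(1) by (auto simp: lform_simps intro!: add_neg_neg mult_pos_neg)
  have "lform y y = a * lform x y + b * lform y z"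
    by (subst (1) y(1)) (simp add: lform_simps lform_commute[of z y])
  then have yy: "lform y y < 0" using xy yz y by (simp add: add_neg_neg mult_pos_neg)
  note iff = crossing_iff[OF dim _ xz(1) yy xy] crossing_iff[OF dim _ yy xz(2) yz]
    crossing_iff[OF dim _ xz] crossing_iff[OF dim _ yy yy yy]
  have "(S \<in> crossing x y \<or> S \<in> crossing y z \<longleftrightarrow> S \<in> crossing x z) \<and>
      (S \<in> crossing x y \<and> S \<in> crossing y z \<longrightarrow> S \<in> crossing y y)" if S: "S \<in> hyperplanes" for S
  proof -
    obtain g where g: "g \<in> O1n" "S = act_set g hyp_S0" using S by (rule hyperplanesE)
    define p q r where "p = lform x (g *v pole)" and "q = lform y (g *v pole)"
      and "r = lform z (g *v pole)"
    have q: "q = a * p + b * r" by (simp add: p_def q_def r_def y(1) lform_simps)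
    have pos: "q > 0" if "p \<ge> 0" "r \<ge> 0" "p > 0 \<or> r > 0"
      using that y(2,3) mult_nonneg_nonneg[of a p] mult_nonneg_nonneg[of b r]
        mult_pos_pos[of a p] mult_pos_pos[of b r] unfolding q by linarith
    have neg: "q < 0" if "p \<le> 0" "r \<le> 0" "p < 0 \<or> r < 0"
      using that y(2,3) mult_nonneg_nonpos[of a p] mult_nonneg_nonpos[of b r]
        mult_pos_neg[of a p] mult_pos_neg[of b r] unfolding q by linarith
    have zero: "q = 0" if "p = 0" "r = 0" using that by (simp add: q)
    show ?thesis
      unfolding g(2) iff[OF g(1)] p_def[symmetric] q_def[symmetric] r_def[symmetric]
      mult_le_0_iff using pos neg zero by (smt (verit))
  qed
  then show "crossing x y \<union> crossing y z = crossing x z" "crossing x y \<inter> crossing y z \<subseteq> crossing y y"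
    using crossing_subset by blast+
qed

definition normalize_timelike :: "'m::{finite,linorder} rvec \<Rightarrow> 'm rvec" where
  "normalize_timelike x = (1 / sqrt (- lform x x)) *\<^sub>R x"

lemma lform_normalize_self:
  assumes "lform x x < 0" shows "lform (normalize_timelike x) (normalize_timelike x) = -1"
  using assms by (simp add: normalize_timelike_def lform_simps)

lemma lform_normalize_neg:
  assumes "lform x x < 0" "lform y y < 0" "lform x y < 0"
  shows "lform (normalize_timelike x) (normalize_timelike y) < 0"
  using assms by (simp add: normalize_timelike_def lform_simps divide_less_0_iff zero_less_divide_iff)

lemma crossing_normalize:
  fixes x y :: "'m::{finite,linorder} rvec"
  assumes dim: "Min UNIV \<noteq> Max (UNIV :: 'm set)"
    and "lform x x < 0" "lform y y < 0" "lform x y < 0"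
  shows "crossing (normalize_timelike x) (normalize_timelike y) = crossing x y"
  unfolding normalize_timelike_def using assms by (intro crossing_scaleR[OF dim]) auto

text \<open>
  The unit-speed geodesic that starts at the origin and is orthogonal to \<open>S\<^sub>0\<close>: a
  standard position for segments of every length.
\<close>

definition ray :: "real \<Rightarrow> 'm::{finite,linorder} rvec" where
  "ray t = cosh t *\<^sub>R origin + sinh t *\<^sub>R pole"

lemma lform_ray:
  assumes dim: "Min UNIV \<noteq> Max (UNIV :: 'm::{finite,linorder} set)"
  shows "lform (ray s) (ray t :: 'm rvec) = - cosh (t - s)"
proof -
  have "(origin :: 'm rvec) $ Max UNIV = 0" "(pole :: 'm rvec) $ Max UNIV = 1"
    using dim by (auto simp: axis_def)
  then show ?thesis
    by (simp add: ray_def lform_simps lform_origin lform_pole[OF dim] cosh_diff)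
qed

lemma ray_0: "ray 0 = origin"
  by (simp add: ray_def)

section \<open>The moment curve\<close>

text \<open>
  The exponents \<open>card {..<j}\<close> number the coordinates by \<open>0, \<dots>, n\<close>.
  The other coordinates are at most \<open>1\<close> on the unit interval, so the constant \<open>n
  + 1\<close> in the first one makes the vectors timelike there.
\<close>

definition moment_curve :: "real \<Rightarrow> 'm::{finite,linorder} rvec" where
  "moment_curve t = (\<chi> j. if j = Min UNIV then real CARD('m) else t ^ card {..<j})"

lemma continuous_on_moment_curve: "continuous_on A moment_curve"
  unfolding moment_curve_def
proof (intro continuous_on_vec_lambda)
  show "continuous_on A (\<lambda>t. if j = Min UNIV then real CARD('a) else t ^ card {..<j})" for j :: 'a
    by (cases "j = Min UNIV") (auto intro!: continuous_intros)
qed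

lemma moment_curve_timelike:
  assumes "0 \<le> t" "t \<le> 1"
  shows "lform (moment_curve t) (moment_curve t :: 'm::{finite,linorder} rvec) < 0"
proof -
  have "(\<Sum>i\<in>UNIV - {Min UNIV}. (moment_curve t :: 'm rvec) $ i * moment_curve t $ i) \<le>
      (\<Sum>i\<in>UNIV - {Min (UNIV :: 'm set)}. 1)"
  proof (rule sum_mono)
    fix i :: 'm assume "i \<in> UNIV - {Min UNIV}"
    then show "(moment_curve t :: 'm rvec) $ i * moment_curve t $ i \<le> 1"
      using assms by (auto simp: moment_curve_def power_le_one intro!: mult_le_one)
  qed
  also have "\<dots> < real CARD('m)"
    by (simp add: card_gt_0_iff)
  also have "\<dots> \<le> real CARD('m) * real CARD('m)"
    by (simp flip: of_nat_mult)
  finally show ?thesis by (simp add: lform_def moment_curve_def)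
qed

text \<open>
  Up to nonzero factors, the coordinates of \<open>v\<close> are the coefficients of the polynomial
  \<open>t \<mapsto> \<langle>moment_curve t, v\<rangle>\<close>.
\<close>

lemma finite_moment_curve_orthogonal:
  fixes v :: "'m::{finite,linorder} rvec"
  assumes "v \<noteq> 0"
  shows "finite {t. lform (moment_curve t) v = 0}"
proof -
  define c where "c j = (if j = Min UNIV then - real CARD('m) else 1) * v $ j" for j
  define p where "p = (\<Sum>j\<in>UNIV. monom (c j) (card {..<j}))"
  have inj: "card {..<j} = card {..<k} \<longleftrightarrow> j = k" for j k :: 'm
  proof -
    have "j < k \<Longrightarrow> card {..<j} < card {..<k}" for j k :: 'm
      by (intro psubset_card_mono) auto
    then show ?thesis by (metis less_irrefl linorder_neqE)
  qed
  have "coeff p (card {..<j}) = c j" for j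
    by (simp add: p_def coeff_sum inj)
  moreover obtain j where "v $ j \<noteq> 0" using assms by (metis vec_eq_iff zero_index)
  then have "c j \<noteq> 0" by (simp add: c_def)
  ultimately have "p \<noteq> 0" by (metis coeff_0)
  moreover have "lform (moment_curve t) v = poly p t" for t
  proof -
    have "{..<Min UNIV :: 'm} = {}" using Min_le[of "UNIV :: 'm set"] by (auto simp: not_less)
    then have "poly p t = c (Min UNIV) + (\<Sum>j\<in>UNIV - {Min UNIV}. c j * t ^ card {..<j})"
      by (simp add: p_def poly_sum poly_monom sum.remove[of UNIV "Min UNIV"])
    then show ?thesis
      by (simp add: lform_def moment_curve_def c_def mult_ac)
  qed
  ultimately show ?thesis using poly_roots_finite by simp
qed

section \<open>Additive functions on the half-line\<close>

text \<open>
  Such an \<open>f\<close> is monotone, so \<open>n f(t) = f(n t)\<close> is squeezed between the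
  values \<open>m f(1)\<close> and \<open>(m + 1) f(1)\<close> at the integers around \<open>n
  t\<close>; dividing by a large \<open>n\<close> gives the claim.
\<close>

lemma additive_nonneg_imp_linear:
  fixes f :: "real \<Rightarrow> real"
  assumes add: "\<And>a b. 0 \<le> a \<Longrightarrow> 0 \<le> b \<Longrightarrow> f (a + b) = f a + f b"
    and nonneg: "\<And>a. 0 \<le> a \<Longrightarrow> 0 \<le> f a" and t: "0 \<le> t"
  shows "f t = f 1 * t"
proof -
  have mono: "f a \<le> f b" if "0 \<le> a" "a \<le> b" for a b
    using add[of a "b - a"] nonneg[of "b - a"] that by simp
  have mult: "f (real n * a) = real n * f a" if "0 \<le> a" for n a
  proof (induction n)
    case 0
    then show ?case using add[of 0 0] by simp
  next
    case (Suc n)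
    then show ?case using add[of "real n * a" a] that by (simp add: algebra_simps)
  qed
  have "\<bar>f t - f 1 * t\<bar> * real n \<le> f 1" for n
  proof -
    define m where "m = nat \<lfloor>real n * t\<rfloor>"
    have m: "real m \<le> real n * t" "real n * t \<le> real (Suc m)"
      using t by (auto simp: m_def) linarith
    have "real m * f 1 \<le> real n * f t" "real n * f t \<le> real (Suc m) * f 1"
      using mono[OF _ m(1)] mono[OF _ m(2)] mult[of 1 m] mult[of 1 "Suc m"] mult[OF t, of n] t
      by auto
    moreover have "real m * f 1 \<le> real n * t * f 1" "real n * t * f 1 \<le> real (Suc m) * f 1"
      using m nonneg[of 1] by (auto intro: mult_right_mono)
    ultimately have "\<bar>real n * f t - real n * t * f 1\<bar> \<le> f 1"
      by (simp add: algebra_simps abs_le_iff)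
    also have "real n * f t - real n * t * f 1 = (f t - f 1 * t) * real n" by (simp add: algebra_simps)
    finally show ?thesis by (simp add: abs_mult)
  qed
  then have "\<bar>f t - f 1 * t\<bar> = 0"
    by (metis abs_ge_zero ex_less_of_nat_mult linorder_not_less mult.commute order_le_less)
  then show ?thesis by simp
qed

section \<open>The measure of the hyperplanes crossing a segment\<close>

lemma closedin_imp_in_Borel_sets:
  assumes "sets M = sigma_sets (topspace T) {U. openin T U}" "closedin T C"
  shows "C \<in> sets M"
proof -
  have "topspace T - (topspace T - C) \<in> sigma_sets (topspace T) {U. openin T U}"
    using assms(2) by (intro sigma_sets.Compl sigma_sets.Basic) (simp add: closedin_def)
  then show ?thesis
    using closedin_subset[OF assms(2)] by (simp add: assms(1) double_diff)
qed

context
  fixes \<mu> :: "'m::{finite,linorder} point set measure"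
  assumes dim: "Min UNIV \<noteq> Max (UNIV :: 'm set)"
    and radon: "radon_measure hyperplane_topology \<mu>"
    and inv: "O1n_invariant \<mu>"
begin

lemma meeting_measurable_finite:
  assumes "compact C" "\<And>p. p \<in> C \<Longrightarrow> lform p p < 0"
  shows "meeting C \<in> sets \<mu>" "emeasure \<mu> (meeting C) < \<infinity>"
proof -
  show "meeting C \<in> sets \<mu>"
    using radon closedin_meeting[OF dim assms]
    by (intro closedin_imp_in_Borel_sets) (auto simp: radon_measure_def)
  show "emeasure \<mu> (meeting C) < \<infinity>"
    using radon compactin_meeting[OF dim assms] by (auto simp: radon_measure_def)
qed

lemma crossing_measurable_finite:
  assumes "lform x x < 0" "lform y y < 0" "lform x y < 0"
  shows "crossing x y \<in> sets \<mu>" "emeasure \<mu> (crossing x y) < \<infinity>"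
  unfolding crossing_def
  using meeting_measurable_finite[OF compact_segment timelike_on_segment[OF assms]] by auto

text \<open>
  An isometry \<open>g\<close> taking one pair to the other maps the hyperplanes crossing the first
  segment into those crossing the second. This yields one inequality; the other follows by
  exchanging the pairs.
\<close>

lemma emeasure_crossing_cong:
  assumes x: "lform x x = -1" "lform x' x' = -1" and y: "lform y y = -1" "lform y' y' = -1"
    and xy: "lform x y = lform x' y'" "lform x y < 0"
  shows "emeasure \<mu> (crossing x y) = emeasure \<mu> (crossing x' y')"
proof -
  have le: "emeasure \<mu> (crossing x y) \<le> emeasure \<mu> (crossing x' y')"
    if x: "lform x x = -1" "lform x' x' = -1" and y: "lform y y = -1" "lform y' y' = -1"
      and xy: "lform x y = lform x' y'" "lform x y < 0" for x y x' y' :: "'m rvec"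
  proof -
    obtain g where g: "g \<in> O1n" "g *v x = x'" "g *v y = y'"
      using O1n_transitive_on_pairs[of x x' y y'] x y xy by auto
    have "crossing x y \<in> sets \<mu>"
      using x y xy by (intro crossing_measurable_finite) auto
    then have "emeasure \<mu> (crossing x y) = emeasure \<mu> (act_set g ` crossing x y)"
      using inv g(1) by (auto simp: O1n_invariant_def)
    also have "\<dots> \<le> emeasure \<mu> (crossing x' y')"
      using act_set_crossing[OF g(1), of x y] g x y xy
      by (intro emeasure_mono crossing_measurable_finite) auto
    finally show ?thesis .
  qed
  show ?thesis using le[of x x' y y'] le[of x' x y' y] assms by (intro antisym) auto
qed

text \<open>
  As the segment from \<open>p\<close> to itself is a point, the set in question is the pencil
  through \<open>p\<close>. Let \<open>q\<^sub>k\<close> be infinitely many points on the moment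
  curve, and \<open>B\<^sub>N\<close> the union of the pencils through \<open>q\<^sub>k\<close> for
  \<open>k \<ge> N\<close>. The sets \<open>B\<^sub>N\<close> have finite mass and decrease to the
  empty set, hence their mass tends to zero, but each of them contains a pencil, and all pencils
  have the same mass.
\<close>

lemma emeasure_pencil:
  assumes p: "lform p p < 0"
  shows "emeasure \<mu> (crossing p p) = 0"
proof -
  define q :: "nat \<Rightarrow> 'm rvec" where "q k = moment_curve (inverse (real (Suc k)))" for k
  have inv01: "0 \<le> inverse (real (Suc k))" "inverse (real (Suc k)) \<le> 1" for k
    by (auto simp: field_simps)
  have q: "lform (q k) (q k) < 0" for k
    unfolding q_def by (intro moment_curve_timelike inv01)
  define B where "B N = (\<Union>k\<in>{N..}. crossing (q k) (q k))" for N
  let ?C = "moment_curve ` {0..1} :: 'm rvec set"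
  have C: "meeting ?C \<in> sets \<mu>" "emeasure \<mu> (meeting ?C) < \<infinity>"
    by (intro meeting_measurable_finite compact_continuous_image continuous_on_moment_curve;
        auto simp: moment_curve_timelike)+
  have meas: "B N \<in> sets \<mu>" for N
    unfolding B_def using crossing_measurable_finite[OF q q q] by (intro sets.countable_UN') auto
  have "q k \<in> ?C" for k unfolding q_def using inv01[of k] by (intro imageI) auto
  then have "B N \<subseteq> meeting ?C" for N
    unfolding B_def crossing_def meeting_def closed_segment_idem by blast
  then have fin: "emeasure \<mu> (B N) \<noteq> \<infinity>" for N
    using emeasure_mono[OF _ C(1)] C(2) by (metis infinity_ennreal_def leD top.not_eq_extremum)
  have "decseq B" unfolding B_def decseq_def by fastforce
  moreover have "\<Inter>(range B) = {}"
  proof (rule ccontr)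
    assume "\<Inter>(range B) \<noteq> {}"
    then obtain S where S: "\<And>N. S \<in> B N" by auto
    then have "S \<in> hyperplanes" using crossing_subset unfolding B_def by blast
    then obtain g where g: "g \<in> O1n" "S = act_set g hyp_S0" by (rule hyperplanesE)
    let ?v = "g *v pole"
    have "S \<in> crossing (q k) (q k) \<longleftrightarrow> lform (q k) ?v = 0" for k
      unfolding g(2) crossing_iff[OF dim g(1) q q q]
      by (metis mult_eq_0_iff order_antisym zero_le_square)
    then have "\<exists>k\<ge>N. lform (q k) ?v = 0" for N
      using S[of N] by (auto simp: B_def)
    then have "infinite {k. lform (q k) ?v = 0}"
      by (simp add: infinite_nat_iff_unbounded_le)
    moreover have "inj (\<lambda>k. inverse (real (Suc k)))"
      by (auto simp: inj_def)
    then have "finite ((\<lambda>k. inverse (real (Suc k))) -` {t. lform (moment_curve t) ?v = 0})"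
      if "?v \<noteq> 0" using finite_vimageI[OF finite_moment_curve_orthogonal[OF that]] by blast
    moreover have "?v \<noteq> 0"
      using O1n_lform[OF g(1), of pole pole] lform_pole[OF dim] by (auto simp: lform.zero_left)
    ultimately show False by (simp add: vimage_def q_def)
  qed
  ultimately have "(\<lambda>N. emeasure \<mu> (B N)) \<longlonglongrightarrow> 0"
    using Lim_emeasure_decseq[of B \<mu>] meas fin by (auto simp: image_subset_iff)
  moreover have "emeasure \<mu> (crossing p p) \<le> emeasure \<mu> (B N)" for N
  proof -
    have "emeasure \<mu> (crossing p p) =
        emeasure \<mu> (crossing (normalize_timelike p) (normalize_timelike p))"
      using p by (simp add: crossing_normalize[OF dim])
    also have "\<dots> = emeasure \<mu> (crossing (normalize_timelike (q N)) (normalize_timelike (q N)))"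
      using p q[of N] by (intro emeasure_crossing_cong) (simp_all add: lform_normalize_self)
    also have "\<dots> = emeasure \<mu> (crossing (q N) (q N))"
      using q[of N] by (simp add: crossing_normalize[OF dim])
    also have "\<dots> \<le> emeasure \<mu> (B N)"
      by (intro emeasure_mono meas) (auto simp: B_def)
    finally show ?thesis .
  qed
  ultimately have "emeasure \<mu> (crossing p p) \<le> 0"
    by (intro LIMSEQ_le_const) auto
  then show ?thesis by simp
qed

text \<open>
  The mass of the hyperplanes that cross a segment of length \<open>t\<close>, computed in standard
  position.
\<close>

definition crossing_mass :: "real \<Rightarrow> real" where
  "crossing_mass t = measure \<mu> (crossing origin (ray t))"

lemma emeasure_crossing:
  assumes "lform x x = -1" "lform y y = -1" "lform x y = - cosh d"
  shows "emeasure \<mu> (crossing x y) = ennreal (crossing_mass d)"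
proof -
  have neg: "lform (ray s) (ray t :: 'm rvec) < 0" for s t
    by (simp add: lform_ray[OF dim])
  have "emeasure \<mu> (crossing (ray 0) (ray d)) < \<infinity>"
    by (intro crossing_measurable_finite neg)
  then have "ennreal (crossing_mass d) = emeasure \<mu> (crossing (ray 0) (ray d))"
    by (simp add: crossing_mass_def ray_0 emeasure_eq_ennreal_measure)
  also have "\<dots> = emeasure \<mu> (crossing x y)"
    using assms by (intro emeasure_crossing_cong) (auto simp: lform_ray[OF dim])
  finally show ?thesis by simp
qed

lemma crossing_mass_add:
  assumes "0 \<le> a" "0 \<le> b"
  shows "crossing_mass (a + b) = crossing_mass a + crossing_mass b"
proof -
  have 0: "crossing_mass 0 = 0"
    using emeasure_pencil[of origin] by (simp add: crossing_mass_def ray_0 lform_origin measure_def)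
  show ?thesis
  proof (cases "a = 0 \<or> b = 0")
    case True
    with 0 show ?thesis by auto
  next
    case False
    with assms have pos: "0 < a" "0 < b" by auto
    have neg: "lform (ray s) (ray t :: 'm rvec) < 0" for s t by (simp add: lform_ray[OF dim])
    \<comment> \<open>The intermediate point of the ray is a positive combination of the end points.\<close>
    have "sinh b + sinh a * cosh (a + b) = sinh (a + b) * cosh a"
      using arg_cong[OF cosh_square_eq[of a], of "\<lambda>u. u * sinh b"]
      by (simp add: sinh_add cosh_add power2_eq_square algebra_simps)
    then have "sinh (a + b) *\<^sub>R (ray a :: 'm rvec) = sinh b *\<^sub>R ray 0 + sinh a *\<^sub>R ray (a + b)"
      by (simp add: ray_def algebra_simps flip: scaleR_add_left)
    from arg_cong[OF this, of "\<lambda>v. (1 / sinh (a + b)) *\<^sub>R v"]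
    have "(ray a :: 'm rvec) = (sinh b / sinh (a + b)) *\<^sub>R ray 0 + (sinh a / sinh (a + b)) *\<^sub>R ray (a + b)"
      using pos by (simp add: scaleR_add_right)
    note split = crossing_split[OF dim neg neg neg this]
    have "crossing (ray 0) (ray a) \<inter> crossing (ray a) (ray (a + b)) \<subseteq> crossing (ray a) (ray a :: 'm rvec)"
      using pos by (intro split) auto
    then have "emeasure \<mu> (crossing (ray 0) (ray a) \<inter> crossing (ray a) (ray (a + b))) = 0"
      using emeasure_pencil[OF neg] crossing_measurable_finite(1)[OF neg neg neg]
      by (metis emeasure_mono le_zero_eq)
    then have "emeasure \<mu> (crossing (ray 0) (ray a)) + emeasure \<mu> (crossing (ray a) (ray (a + b))) =
        emeasure \<mu> (crossing (ray 0) (ray a) \<union> crossing (ray a) (ray (a + b)))"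
      using emeasure_Un_Int[OF crossing_measurable_finite(1)[OF neg neg neg]
        crossing_measurable_finite(1)[OF neg neg neg]] by simp
    also have "crossing (ray 0) (ray a :: 'm rvec) \<union> crossing (ray a) (ray (a + b)) =
        crossing (ray 0) (ray (a + b))"
      using pos by (intro split) auto
    finally have "ennreal (crossing_mass a) + ennreal (crossing_mass b) = ennreal (crossing_mass (a + b))"
      by (simp add: emeasure_crossing[of _ _ a] emeasure_crossing[of _ _ b]
          emeasure_crossing[of _ _ "a + b"] lform_ray[OF dim])
    then show ?thesis
      by (simp add: crossing_mass_def flip: ennreal_plus)
  qed
qed

lemma crossing_mass_linear: "0 \<le> t \<Longrightarrow> crossing_mass t = crossing_mass 1 * t"
  using crossing_mass_add
  by (rule additive_nonneg_imp_linear) (auto simp: crossing_mass_def)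

text \<open>
  For a segment whose end points lie strictly on the two sides of \<open>S\<close>, crossing
  \<open>S\<close> is stable under small perturbations of the end points. The images under
  \<open>g\<close> of points on both sides of \<open>S\<^sub>0\<close> give such a segment.
\<close>

lemma hyperplane_crosses_open_set_of_pairs:
  assumes "(S :: 'm point set) \<in> hyperplanes"
  obtains U where "open U" "U \<noteq> {}"
    "\<And>x y. (x, y) \<in> U \<Longrightarrow> lform x x < 0 \<and> lform y y < 0 \<and> lform x y < 0 \<and> S \<in> crossing x y"
proof -
  obtain g where g: "g \<in> O1n" "S = act_set g hyp_S0" using assms by (rule hyperplanesE)
  let ?v = "g *v pole"
  define U where "U = {z :: 'm rvec \<times> 'm rvec. lform (fst z) (fst z) < 0 \<and>
    lform (snd z) (snd z) < 0 \<and> lform (fst z) (snd z) < 0 \<and> 0 < lform (fst z) ?v \<and> lform (snd z) ?v < 0}"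
  have "open U"
    unfolding U_def
    by (intro open_Collect_conj open_Collect_less lform.continuous_on continuous_intros)
  \<comment> \<open>The vectors \<open>2 e\<^sub>0 \<plusminus> e\<close> are negative, have negative product, and lie on the two sides of \<open>S\<^sub>0\<close>.\<close>
  moreover have "(origin :: 'm rvec) $ Max UNIV = 0" "(pole :: 'm rvec) $ Max UNIV = 1"
    using dim by (auto simp: axis_def)
  then have "(g *v (2 *\<^sub>R origin + pole), g *v (2 *\<^sub>R origin - pole)) \<in> U"
    by (simp add: U_def O1n_lform[OF g(1)] lform_simps lform_origin lform_pole[OF dim])
  moreover have "lform x x < 0 \<and> lform y y < 0 \<and> lform x y < 0 \<and> S \<in> crossing x y"
    if "(x, y) \<in> U" for x y
    using that crossing_iff[OF dim g(1), of x y] by (auto simp: U_def g(2) mult_le_0_iff)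
  ultimately show ?thesis using that[of U] by blast
qed

text \<open>
  By the preceding lemma each hyperplane crosses one of the countably many segments with end points
  in a countable dense set of pairs. If the hyperplanes crossing any one segment had mass zero, so
  would all hyperplanes together.
\<close>

lemma crossing_mass_pos:
  assumes "emeasure \<mu> (space \<mu>) \<noteq> 0"
  shows "0 < crossing_mass 1"
proof (rule ccontr)
  assume "\<not> 0 < crossing_mass 1"
  then have "crossing_mass 1 = 0"
    by (simp add: crossing_mass_def zero_less_measure_iff)
  then have zero: "crossing_mass t = 0" if "0 \<le> t" for t
    using crossing_mass_linear[OF that] by simp
  have null: "crossing x y \<in> null_sets \<mu>" if xy: "lform x x < 0" "lform y y < 0" "lform x y < 0" for x y
  proof -
    let ?x = "normalize_timelike x" and ?y = "normalize_timelike y"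
    have u: "lform ?x ?x = -1" "lform ?y ?y = -1" "lform ?x ?y < 0"
      using lform_normalize_self lform_normalize_neg xy by auto
    then have "1 \<le> - lform ?x ?y"
      using lform_reverse_Cauchy_Schwarz[of ?x ?y] by simp
    then have "lform ?x ?y = - cosh (arcosh (- lform ?x ?y))" "0 \<le> arcosh (- lform ?x ?y)"
      by auto
    then have "emeasure \<mu> (crossing ?x ?y) = 0"
      using emeasure_crossing[OF u(1,2)] zero by (metis ennreal_0)
    then show ?thesis
      using crossing_measurable_finite(1)[OF xy] by (simp add: crossing_normalize[OF dim xy] null_setsI)
  qed
  obtain D :: "('m rvec \<times> 'm rvec) set" where D: "countable D"
      "\<And>U. open U \<Longrightarrow> U \<noteq> {} \<Longrightarrow> \<exists>d\<in>D. d \<in> U"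
    using countable_dense_setE by blast
  define D' where "D' = {(x, y) \<in> D. lform x x < 0 \<and> lform y y < 0 \<and> lform x y < 0}"
  have "hyperplanes \<subseteq> (\<Union>(x, y)\<in>D'. crossing x y)"
  proof
    fix S :: "'m point set" assume "S \<in> hyperplanes"
    then obtain U where U: "open U" "U \<noteq> {}"
      "\<And>x y. (x, y) \<in> U \<Longrightarrow> lform x x < 0 \<and> lform y y < 0 \<and> lform x y < 0 \<and> S \<in> crossing x y"
      by (rule hyperplane_crosses_open_set_of_pairs) blast
    obtain d where "d \<in> D" "d \<in> U" using D(2)[OF U(1,2)] by blast
    then show "S \<in> (\<Union>(x, y)\<in>D'. crossing x y)"
      using U(3)[of "fst d" "snd d"] by (force simp: D'_def)
  qed
  moreover have "countable D'" using D(1) by (rule countable_subset[rotated]) (auto simp: D'_def)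
  then have "(\<Union>(x, y)\<in>D'. crossing x y) \<in> null_sets \<mu>"
    using null by (intro null_sets_UN') (auto simp: D'_def)
  moreover have "space \<mu> = hyperplanes"
    using radon by (simp add: radon_measure_def topspace_hyperplane_topology)
  ultimately have "space \<mu> \<in> null_sets \<mu>"
    using null_sets_subset by (metis sets.top)
  then show False using assms by auto
qed

end

section \<open>Geodesic segments\<close>

lemma hyp_spaceE:
  assumes "P \<in> hyp_space"
  obtains x where "lform x x = -1" "P = proj_class x"
proof -
  obtain z where z: "lform z z < 0" "P = proj_class z" using assms by (auto simp: hyp_space_def)
  show ?thesis
    using z that[of "(1 / sqrt (- lform z z)) *\<^sub>R z"] by (simp add: lform_simps proj_class_scaleR)
qed

lemma unit_representatives_abs_lform:
  assumes "lform x x = -1" "lform y y = -1"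
  shows "\<bar>lform x y\<bar> = cosh (hyp_dist (proj_class x) (proj_class y))"
  using hyp_dist_proj_class(2)[of x y] assms by simp

lemma hyp_dist_eqI:
  assumes "lform x x = -1" "lform y y = -1" "0 \<le> d" "\<bar>lform x y\<bar> = cosh d"
  shows "hyp_dist (proj_class x) (proj_class y) = d"
proof -
  have "cosh (hyp_dist (proj_class x) (proj_class y)) = cosh d"
    using unit_representatives_abs_lform[OF assms(1,2)] assms(4) by simp
  then show ?thesis
    using assms hyp_dist_proj_class(1)[of x y] by (metis arcosh_cosh_real neg_less_0_iff_less zero_less_one)
qed

lemma unit_timelike_eq_or_opposite:
  assumes x: "lform x x = -1" and y: "lform y y = -1" and "\<bar>lform x y\<bar> \<le> 1"
  shows "x = y \<or> x = - y"
proof -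
  have "\<bar>lform x y\<bar> = 1"
    using assms lform_reverse_Cauchy_Schwarz[of x y] by simp
  then consider "lform x y = -1" | "lform x (- y) = -1"
    by (auto simp: lform_simps abs_if split: if_splits)
  then show ?thesis
    using unit_timelike_eqI[of x y] unit_timelike_eqI[of x "- y"] x y
    by cases (auto simp: lform_simps)
qed

lemma hyp_space_pairE:
  assumes "P \<in> hyp_space" "Q \<in> hyp_space"
  obtains x y where "lform x x = -1" "lform y y = -1" "lform x y = - cosh (hyp_dist P Q)"
    "P = proj_class x" "Q = proj_class y"
proof -
  obtain x where x: "lform x x = -1" "P = proj_class x" using assms(1) by (rule hyp_spaceE)
  obtain z where z: "lform z z = -1" "Q = proj_class z" using assms(2) by (rule hyp_spaceE)
  have abs: "\<bar>lform x z\<bar> = cosh (hyp_dist P Q)"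
    using unit_representatives_abs_lform[OF x(1) z(1)] x z by simp
  show ?thesis
  proof (cases "lform x z < 0")
    case True
    then have "lform x z = - cosh (hyp_dist P Q)" using abs by simp
    then show ?thesis using that[of x z] x z by blast
  next
    case False
    have "lform (- z) (- z) = -1" "lform x (- z) = - cosh (hyp_dist P Q)"
      using False z abs by (simp_all add: lform_simps)
    moreover have "Q = proj_class (- z)"
      using proj_class_scaleR[of "-1" z] z by simp
    ultimately show ?thesis using that[of x "- z"] x by blast
  qed
qed

context
  fixes x y :: "'m::{finite,linorder} rvec" and d :: real
  assumes x: "lform x x = -1" and y: "lform y y = -1" and d: "0 \<le> d" and xy: "lform x y = - cosh d"
begin

text \<open>
  For \<open>d > 0\<close> the vector \<open>y - cosh d x\<close>, divided by \<open>sinh d\<close>,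
  is the unit tangent vector at \<open>x\<close> towards \<open>y\<close>. For \<open>d = 0\<close>
  the quotient is \<open>0\<close> and the path stays on the line of \<open>x\<close>.
\<close>

definition unit_speed :: "real \<Rightarrow> 'm rvec" where
  "unit_speed t = cosh t *\<^sub>R x + (sinh t / sinh d) *\<^sub>R (y - cosh d *\<^sub>R x)"

lemma distance_eq: "hyp_dist (proj_class x) (proj_class y) = d"
  using x y d xy by (intro hyp_dist_eqI) auto

lemma endpoints_eq_if_d_0: "d = 0 \<Longrightarrow> y = x"
  using unit_timelike_eqI[OF x y] xy by simp

lemma unit_speed_ends: "unit_speed 0 = x" "unit_speed d = y"
proof -
  show "unit_speed 0 = x" by (simp add: unit_speed_def)
  show "unit_speed d = y"
  proof (cases "d = 0")
    case True
    then have "y = x" "sinh d = 0" "cosh d = 1" using endpoints_eq_if_d_0 by auto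
    then show ?thesis unfolding unit_speed_def by simp
  next
    case False
    then show ?thesis by (simp add: unit_speed_def)
  qed
qed

lemma lform_unit_speed:
  assumes s: "s \<in> {0..d}" and t: "t \<in> {0..d}"
  shows "lform (unit_speed s) (unit_speed t) = - cosh (s - t)"
proof (cases "d = 0")
  case True
  then have "s = 0" "t = 0" using s t by auto
  then show ?thesis by (simp add: unit_speed_ends x)
next
  case False
  define w where "w = (1 / sinh d) *\<^sub>R (y - cosh d *\<^sub>R x)"
  have sd: "sinh d \<noteq> 0" using False by simp
  have "lform x w = 0"
    using x xy by (simp add: w_def lform_simps)
  moreover have "lform w w = 1"
  proof -
    have "lform (y - cosh d *\<^sub>R x) (y - cosh d *\<^sub>R x) = (sinh d)\<^sup>2"
      using x y xy cosh_square_eq[of d]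
      by (simp add: lform_simps lform_commute[of y x] power2_eq_square)
    then show ?thesis
      using sd by (simp add: w_def lform.scaleR_left lform.scaleR_right power2_eq_square)
  qed
  moreover have "unit_speed t = cosh t *\<^sub>R x + sinh t *\<^sub>R w" for t
    by (simp add: unit_speed_def w_def)
  ultimately show ?thesis
    using x by (simp add: lform_simps lform_commute[of w x] cosh_diff)
qed

lemma unit_speed_combination: "sinh d *\<^sub>R unit_speed t = sinh (d - t) *\<^sub>R x + sinh t *\<^sub>R y"
proof (cases "d = 0")
  case True
  then show ?thesis by (simp add: endpoints_eq_if_d_0)
next
  case False
  then have "sinh d *\<^sub>R unit_speed t = (sinh d * cosh t) *\<^sub>R x + sinh t *\<^sub>R (y - cosh d *\<^sub>R x)"
    by (simp add: unit_speed_def scaleR_add_right)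
  then show ?thesis
    by (simp add: sinh_diff algebra_simps)
qed

text \<open>
  Uniqueness of the geodesic: let \<open>m\<close> be a unit vector over a point at distance
  \<open>t\<close> from \<open>x\<close> and \<open>d - t\<close> from \<open>y\<close>. Since
  \<open>sinh d\<close> times the point at time \<open>t\<close> of the standard path is \<open>sinh
  (d - t) x + sinh t y\<close>, its product with \<open>m\<close> is at most \<open>sinh d\<close>
  in absolute value by the addition theorem. So \<open>m\<close> and the standard point have product
  at most \<open>1\<close> in absolute value, which for negative unit vectors forces them to agree
  up to sign.
\<close>

lemma is_geodesic_segment_iff:
  "is_geodesic_segment (proj_class x) (proj_class y) s \<longleftrightarrow>
     s = (\<lambda>t. proj_class (unit_speed t)) ` {0..d}"
proof -
  have unit: "lform (unit_speed t) (unit_speed t) = -1" if "t \<in> {0..d}" for t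
    using lform_unit_speed[OF that that] by simp
  show ?thesis
  proof
    assume s: "s = (\<lambda>t. proj_class (unit_speed t)) ` {0..d}"
    have "hyp_dist (proj_class (unit_speed a)) (proj_class (unit_speed b)) = \<bar>a - b\<bar>"
      if "a \<in> {0..d}" "b \<in> {0..d}" for a b
      using unit that lform_unit_speed[OF that] by (intro hyp_dist_eqI) auto
    moreover have "s \<subseteq> hyp_space"
      unfolding s hyp_space_def using unit by fastforce
    ultimately show "is_geodesic_segment (proj_class x) (proj_class y) s"
      unfolding is_geodesic_segment_def distance_eq using s unit_speed_ends
      by (intro exI[of _ "\<lambda>t. proj_class (unit_speed t)"]) simp
  next
    assume "is_geodesic_segment (proj_class x) (proj_class y) s"
    then obtain \<gamma> where \<gamma>: "\<gamma> 0 = proj_class x" "\<gamma> d = proj_class y" "\<gamma> ` {0..d} = s" "s \<subseteq> hyp_space"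
      and iso: "\<forall>a\<in>{0..d}. \<forall>b\<in>{0..d}. hyp_dist (\<gamma> a) (\<gamma> b) = \<bar>a - b\<bar>"
      unfolding is_geodesic_segment_def distance_eq by (elim exE conjE) (rule that)
    have "\<gamma> t = proj_class (unit_speed t)" if t: "t \<in> {0..d}" for t
    proof (cases "d = 0")
      case True
      then have "t = 0" using t by auto
      then show ?thesis using \<gamma>(1) unit_speed_ends(1) by simp
    next
      case False
      have "\<gamma> t \<in> hyp_space" using \<gamma> t by blast
      then obtain m where m: "lform m m = -1" "\<gamma> t = proj_class m" by (rule hyp_spaceE)
      have "hyp_dist (proj_class m) (proj_class x) = \<bar>t - 0\<bar>"
        unfolding m(2)[symmetric] \<gamma>(1)[symmetric] using iso t d by auto
      then have mx: "\<bar>lform m x\<bar> = cosh t"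
        using unit_representatives_abs_lform[OF m(1) x] t by simp
      have "hyp_dist (proj_class m) (proj_class y) = \<bar>t - d\<bar>"
        unfolding m(2)[symmetric] \<gamma>(2)[symmetric] using iso t d by auto
      then have my: "\<bar>lform m y\<bar> = cosh (d - t)"
        using unit_representatives_abs_lform[OF m(1) y] t by simp
      have "sinh d * \<bar>lform m (unit_speed t)\<bar> = \<bar>lform m (sinh d *\<^sub>R unit_speed t)\<bar>"
        using d by (simp add: lform.scaleR_right abs_mult)
      also have "\<dots> = \<bar>sinh (d - t) * lform m x + sinh t * lform m y\<bar>"
        by (simp add: unit_speed_combination lform_simps)
      also have "\<dots> \<le> sinh (d - t) * cosh t + sinh t * cosh (d - t)"
        using abs_triangle_ineq[of "sinh (d - t) * lform m x" "sinh t * lform m y"] t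
        by (simp add: abs_mult mx my)
      also have "\<dots> = sinh d" using sinh_add[of "d - t" t] by (simp add: mult.commute)
      finally have "\<bar>lform m (unit_speed t)\<bar> \<le> 1" using False d by simp
      then have "m = unit_speed t \<or> m = - unit_speed t"
        using m unit[OF t] by (intro unit_timelike_eq_or_opposite)
      then show ?thesis using proj_class_scaleR[of "-1" "unit_speed t"] m(2) by auto
    qed
    then show "s = (\<lambda>t. proj_class (unit_speed t)) ` {0..d}"
      unfolding \<gamma>(3)[symmetric] by (intro image_cong) auto
  qed
qed

lemma geodesic_segment_eq:
  "geodesic_segment (proj_class x) (proj_class y) = (\<lambda>t. proj_class (unit_speed t)) ` {0..d}"
  unfolding geodesic_segment_def is_geodesic_segment_iff by simp

text \<open>
  Along the path, the linear form that vanishes on the hyperplane is a combination of its values at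
  the end points with nonnegative coefficients, not both zero when \<open>d > 0\<close>, so a zero
  prevents these from having the same strict sign; the converse is the intermediate value theorem.
\<close>

lemma crossing_geodesic_segment:
  assumes dim: "Min UNIV \<noteq> Max (UNIV :: 'm set)"
  shows "{S \<in> hyperplanes. S \<inter> geodesic_segment (proj_class x) (proj_class y) \<noteq> {}} = crossing x y"
proof -
  have "S \<inter> geodesic_segment (proj_class x) (proj_class y) \<noteq> {} \<longleftrightarrow> S \<in> crossing x y"
    if S: "S \<in> hyperplanes" for S
  proof -
    obtain g where g: "g \<in> O1n" "S = act_set g hyp_S0" using S by (rule hyperplanesE)
    define \<phi> where "\<phi> t = lform (unit_speed t) (g *v pole)" for t
    have "proj_class (unit_speed t) \<in> S \<longleftrightarrow> \<phi> t = 0" if "t \<in> {0..d}" for t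
      unfolding g(2) \<phi>_def using lform_unit_speed[OF that that]
      by (intro proj_class_mem_hyperplane[OF dim g(1)]) simp
    then have "S \<inter> geodesic_segment (proj_class x) (proj_class y) \<noteq> {} \<longleftrightarrow> (\<exists>t\<in>{0..d}. \<phi> t = 0)"
      unfolding geodesic_segment_eq by blast
    also have "\<dots> \<longleftrightarrow> \<phi> 0 * \<phi> d \<le> 0"
    proof
      assume "\<exists>t\<in>{0..d}. \<phi> t = 0"
      then obtain t where t: "t \<in> {0..d}" "\<phi> t = 0" by blast
      have comb: "sinh d * \<phi> t = sinh (d - t) * \<phi> 0 + sinh t * \<phi> d"
        unfolding \<phi>_def unit_speed_ends using unit_speed_combination[of t]
        by (metis lform.add_left lform.scaleR_left real_scaleR_def)
      show "\<phi> 0 * \<phi> d \<le> 0"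
      proof (rule ccontr)
        assume "\<not> \<phi> 0 * \<phi> d \<le> 0"
        then have "0 < \<phi> 0 * \<phi> d" by simp
        moreover from this have "0 < \<phi> 0 * \<phi> 0" by (auto simp: zero_less_mult_iff)
        ultimately have same: "0 < \<phi> 0 * \<phi> d" "0 < \<phi> 0 * \<phi> 0" .
        have "0 = sinh (d - t) * (\<phi> 0 * \<phi> 0) + sinh t * (\<phi> 0 * \<phi> d)"
          using arg_cong[OF comb, of "\<lambda>u. \<phi> 0 * u"] t by (simp add: algebra_simps)
        moreover have "0 \<le> sinh (d - t)" "0 \<le> sinh t" using t by auto
        ultimately have "sinh (d - t) = 0" "sinh t = 0"
          using same by (smt (verit) mult_nonneg_nonneg mult_pos_pos)+
        then have "t = 0" "d = 0" by auto
        then show False using t same by auto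
      qed
    next
      assume "\<phi> 0 * \<phi> d \<le> 0"
      moreover have "continuous_on {0..d} \<phi>"
        unfolding \<phi>_def unit_speed_def divide_inverse
        by (intro lform.continuous_on continuous_intros)
      ultimately have "(\<exists>t\<ge>0. t \<le> d \<and> \<phi> t = 0)"
        using IVT'[of \<phi> 0 0 d] IVT2'[of \<phi> d 0 0] d by (auto simp: mult_le_0_iff)
      then show "\<exists>t\<in>{0..d}. \<phi> t = 0" by auto
    qed
    also have "\<dots> \<longleftrightarrow> S \<in> crossing x y"
      unfolding g(2) \<phi>_def unit_speed_ends using x y xy
      by (intro crossing_iff[OF dim g(1), symmetric]) auto
    finally show ?thesis .
  qed
  then show ?thesis using crossing_subset by blast
qed

end

section \<open>The measure formula\<close>

theorem proposition2p1:
  fixes n :: nat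
    and \<mu> :: "('m::{finite,linorder}) point set measure"
  assumes "n \<ge> 1"
    and "CARD('m) = n + 1"
    and "radon_measure hyperplane_topology \<mu>"
    and "O1n_invariant \<mu>"
    and "emeasure \<mu> (space \<mu>) \<noteq> 0"
  shows "\<exists>k::real. k > 0 \<and>
    (\<forall>x\<in>hyp_space. \<forall>y\<in>hyp_space.
       {S \<in> hyperplanes. S \<inter> geodesic_segment x y \<noteq> {}} \<in> sets \<mu> \<and>
       emeasure \<mu> {S \<in> hyperplanes. S \<inter> geodesic_segment x y \<noteq> {}} = ennreal (k * hyp_dist x y))"
proof -
  have dim: "Min UNIV \<noteq> Max (UNIV :: 'm set)"
  proof
    assume "Min UNIV = Max (UNIV :: 'm set)"
    then have "i = Max UNIV" for i :: 'm
      by (metis Max_ge Min_le UNIV_I finite antisym)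
    then have "(UNIV :: 'm set) = {Max UNIV}" by blast
    then have "CARD('m) = card {Max (UNIV :: 'm set)}" by (rule arg_cong)
    then show False using assms(1,2) by simp
  qed
  note radon = assms(3) and inv = assms(4)
  let ?k = "crossing_mass \<mu> 1"
  have "{S \<in> hyperplanes. S \<inter> geodesic_segment P Q \<noteq> {}} \<in> sets \<mu> \<and>
       emeasure \<mu> {S \<in> hyperplanes. S \<inter> geodesic_segment P Q \<noteq> {}} = ennreal (?k * hyp_dist P Q)"
    if PQ: "P \<in> hyp_space" "Q \<in> hyp_space" for P Q
  proof -
    obtain x y where xy: "lform x x = -1" "lform y y = -1" "lform x y = - cosh (hyp_dist P Q)"
      "P = proj_class x" "Q = proj_class y"
      using PQ by (rule hyp_space_pairE)
    have d: "0 \<le> hyp_dist P Q" using xy hyp_dist_proj_class(1)[of x y] by simp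
    have "{S \<in> hyperplanes. S \<inter> geodesic_segment P Q \<noteq> {}} = crossing x y"
      using crossing_geodesic_segment[OF xy(1,2) d xy(3) dim] xy(4,5) by simp
    moreover have "crossing x y \<in> sets \<mu>"
      using xy by (intro crossing_measurable_finite[OF dim radon inv]) auto
    moreover have "emeasure \<mu> (crossing x y) = ennreal (?k * hyp_dist P Q)"
      using emeasure_crossing[OF dim radon inv xy(1-3)] crossing_mass_linear[OF dim radon inv d]
      by simp
    ultimately show ?thesis by simp
  qed
  moreover have "0 < ?k" using crossing_mass_pos[OF dim radon inv assms(5)] .
  ultimately show ?thesis by blast
qed

end
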